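(* For any fixed $c>0$, the algorithm Online-Lazy is, up to its arbitrary choice, the unique optimal algorithm for the Online I problem, and the expected number of clauses accepted by an optimal Online I algorithm satisfies $$f_{\mathrm{O\text{-}I}}(n,cn)\asymp\left(\tfrac34c+\tfrac{1-e^{-c}}4+\tfrac{(1-e^{-c})^2}8\right)n\le\left(\tfrac34c+\tfrac38\right)n.$$
   Context: Online I MAX 2-SAT: numbers $n$ (variables) and $m$ (clauses) are known in advance; the $m$ clauses of a random 2-SAT formula $F(n,m)$ (each clause chosen independently and uniformly, with replacement, from the $2^2\binom n2$ disjunctions of two literals on two distinct variables among $X_1,\dots,X_n$) are presented one at a time, and on presentation of clause $c_i$ the algorithm must decide, based only on $c_1,\dots,c_i$, whether to accept or reject it. When a clause is accepted it must be satisfied immediately, by setting at least one of its literals True; once a variable is set, its value can never be changed. The goal is to maximize the number of accepted clauses; $f_{\mathrm{O\text{-}I}}(n,m)$ is the expected number of clauses accepted by an optimal algorithm. Online-Lazy starts with all variables unset; on clause $(X\vee Y)$: if $X$ or $Y$ is True, accept; if both are False, reject; if one is False and the other unset, set the unset literal True and accept; if both are unset, arbitrarily choose one, set it True, and accept. Notation: $a(n)\asymp b(n)$ means $a(n)/b(n)\to1$ as $n\to\infty$; $cn$ means $\lfloor cn\rfloor$.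
   Formalization: Uniqueness is proved for all accept/reject decisions and for the assignment held whenever a clause is presented; the assignment after the very last clause is not compared, since setting both literals of that clause True is also optimal there. *)

theory Defs
  imports "HOL-Probability.Probability"
begin

text \<open>The literal \<open>(i, True)\<close> is the variable \<open>X\<^sub>i\<close>, and \<open>(i, False)\<close> is its negation.
  A clause is the disjunction of its two literals; listing the literal with the smaller
  variable first picks one representative of each (unordered) disjunction.\<close>

type_synonym literal = "nat \<times> bool"
type_synonym clause = "literal \<times> literal"
type_synonym assignment = "nat \<rightharpoonup> bool"

definition clauses :: "nat \<Rightarrow> clause set" where
  "clauses n = {((i, a), (j, b)) | i a j b. 1 \<le> i \<and> i < j \<and> j \<le> n}"

lemma finite_clauses: "finite (clauses n)"
proof (rule finite_subset)
  show "clauses n \<subseteq> ({1..n} \<times> UNIV) \<times> ({1..n} \<times> UNIV)"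
    unfolding clauses_def by clarsimp
qed (intro finite_cartesian_product; simp)

lemma card_clauses: "card (clauses n) = 2\<^sup>2 * (n choose 2)"
proof (induction n)
  case 0
  have "clauses 0 = {}" unfolding clauses_def by clarsimp
  then show ?case by simp
next
  case (Suc n)
  define N where "N = (({1..n} \<times> UNIV) \<times> ({Suc n} \<times> UNIV) :: clause set)"
  have "finite N" unfolding N_def by (intro finite_cartesian_product; simp)
  moreover have "clauses (Suc n) = clauses n \<union> N"
    unfolding clauses_def N_def by (intro set_eqI iffI; clarsimp; linarith)
  moreover have "clauses n \<inter> N = {}"
    unfolding clauses_def N_def by (intro equals0I; clarsimp)
  moreover have "card N = 4 * n"
    unfolding N_def by (simp only: card_cartesian_product card_UNIV_bool) simp
  ultimately have "card (clauses (Suc n)) = card (clauses n) + 4 * n"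
    by (simp add: card_Un_disjoint finite_clauses)
  moreover have "Suc n choose 2 = n + (n choose 2)"
    using binomial_Suc_Suc[of n 1] by (simp only: Suc_1 One_nat_def[symmetric] choose_one)
  ultimately show ?case using Suc.IH by simp
qed

definition random_formula :: "nat \<Rightarrow> nat \<Rightarrow> clause list pmf" where
  "random_formula n m = replicate_pmf m (pmf_of_set (clauses n))"

definition lit_true :: "assignment \<Rightarrow> literal \<Rightarrow> bool" where
  "lit_true \<sigma> l \<longleftrightarrow> \<sigma> (fst l) = Some (snd l)"

definition lit_false :: "assignment \<Rightarrow> literal \<Rightarrow> bool" where
  "lit_false \<sigma> l \<longleftrightarrow> \<sigma> (fst l) = Some (\<not> snd l)"

definition satisfies :: "assignment \<Rightarrow> clause \<Rightarrow> bool" where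
  "satisfies \<sigma> c \<longleftrightarrow> lit_true \<sigma> (fst c) \<or> lit_true \<sigma> (snd c)"

definition set_true :: "assignment \<Rightarrow> literal \<Rightarrow> assignment" where
  "set_true \<sigma> l = \<sigma>(fst l \<mapsto> snd l)"

text \<open>An online algorithm is a function of the clauses \<open>h = [c\<^sub>1, \<dots>, c\<^sub>i]\<close> presented so far:
  \<open>accepts A h\<close> tells whether the last of them is accepted (it is meaningless for \<open>h = []\<close>), and
  \<open>assigns A h\<close> is the partial assignment held once the last of them has been dealt with.\<close>

record online_algorithm =
  accepts :: "clause list \<Rightarrow> bool"
  assigns :: "clause list \<Rightarrow> assignment"

text \<open>The rules of the Online I problem.  They do not restrict which unset variables may be set
  when a clause is presented; in particular, an algorithm may set more than it needs to.\<close>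

definition online_I :: "nat \<Rightarrow> nat \<Rightarrow> online_algorithm \<Rightarrow> bool" where
  "online_I n m A \<longleftrightarrow>
     assigns A [] = Map.empty \<and>
     (\<forall>h c. set (h @ [c]) \<subseteq> clauses n \<and> length (h @ [c]) \<le> m \<longrightarrow>
        dom (assigns A (h @ [c])) \<subseteq> {1..n} \<and>
        assigns A h \<subseteq>\<^sub>m assigns A (h @ [c]) \<and>
        (accepts A (h @ [c]) \<longrightarrow> satisfies (assigns A (h @ [c])) c))"

definition num_accepted :: "online_algorithm \<Rightarrow> clause list \<Rightarrow> nat" where
  "num_accepted A cs = card {i \<in> {1..length cs}. accepts A (take i cs)}"

definition expected_accepted :: "nat \<Rightarrow> nat \<Rightarrow> online_algorithm \<Rightarrow> real" where
  "expected_accepted n m A =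
     measure_pmf.expectation (random_formula n m) (\<lambda>cs. real (num_accepted A cs))"

definition optimal_online_I :: "nat \<Rightarrow> nat \<Rightarrow> online_algorithm \<Rightarrow> bool" where
  "optimal_online_I n m A \<longleftrightarrow>
     online_I n m A \<and> (\<forall>B. online_I n m B \<longrightarrow> expected_accepted n m B \<le> expected_accepted n m A)"

definition f_OI :: "nat \<Rightarrow> nat \<Rightarrow> real" where
  "f_OI n m = (SUP A \<in> {A. online_I n m A}. expected_accepted n m A)"

lemma f_OI_eq_optimal:
  assumes "optimal_online_I n m A"
  shows "f_OI n m = expected_accepted n m A"
  unfolding f_OI_def using assms
  by (intro cSup_eq_maximum) (auto simp: optimal_online_I_def)

text \<open>If both literals of a clause are unset, Online-Lazy makes an arbitrary choice between
  them.  This choice is the parameter \<open>first\<close> of a single step, and it may depend on the whole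
  history, as described by the parameter \<open>\<kappa>\<close> of the algorithm.\<close>

definition lazy_step :: "bool \<Rightarrow> assignment \<Rightarrow> clause \<Rightarrow> bool \<times> assignment" where
  "lazy_step first \<sigma> c =
     (let X = fst c; Y = snd c in
      if lit_true \<sigma> X \<or> lit_true \<sigma> Y then (True, \<sigma>)
      else if lit_false \<sigma> X \<and> lit_false \<sigma> Y then (False, \<sigma>)
      else if lit_false \<sigma> X then (True, set_true \<sigma> Y)
      else if lit_false \<sigma> Y then (True, set_true \<sigma> X)
      else (True, set_true \<sigma> (if first then X else Y)))"

primrec lazy_state :: "(clause list \<Rightarrow> bool) \<Rightarrow> clause list \<Rightarrow> nat \<Rightarrow> assignment" where
  "lazy_state \<kappa> h 0 = Map.empty"
| "lazy_state \<kappa> h (Suc i) =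
     snd (lazy_step (\<kappa> (take (Suc i) h)) (lazy_state \<kappa> h i) (h ! i))"

definition online_lazy :: "(clause list \<Rightarrow> bool) \<Rightarrow> online_algorithm" where
  "online_lazy \<kappa> =
     \<lparr>accepts = (\<lambda>h. fst (lazy_step (\<kappa> h) (lazy_state \<kappa> h (length h - 1)) (last h))),
      assigns = (\<lambda>h. lazy_state \<kappa> h (length h))\<rparr>"

lemma lazy_state_append: "i \<le> length h \<Longrightarrow> lazy_state \<kappa> (h @ h') i = lazy_state \<kappa> h i"
  by (induction i) (auto simp: nth_append)

lemma online_lazy_Nil: "assigns (online_lazy \<kappa>) [] = Map.empty"
  by (simp add: online_lazy_def)

lemma online_lazy_snoc:
  "(accepts (online_lazy \<kappa>) (h @ [c]), assigns (online_lazy \<kappa>) (h @ [c])) =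
     lazy_step (\<kappa> (h @ [c])) (assigns (online_lazy \<kappa>) h) c"
  by (simp add: online_lazy_def lazy_state_append)

text \<open>Two algorithms agree if they make the same decision on every clause and hold the same
  assignment whenever a clause is presented.  The assignment left after the \<open>m\<close>-th clause is not
  compared: no decision depends on it, and setting superfluous variables at that point would
  cost nothing.\<close>

definition agree :: "nat \<Rightarrow> nat \<Rightarrow> online_algorithm \<Rightarrow> online_algorithm \<Rightarrow> bool" where
  "agree n m A B \<longleftrightarrow>
     (\<forall>h c. set (h @ [c]) \<subseteq> clauses n \<and> length (h @ [c]) \<le> m \<longrightarrow>
        assigns A h = assigns B h \<and> accepts A (h @ [c]) = accepts B (h @ [c]))"

end

theory Submission
  imports Defs
begin

text \<open>For Online-Lazy with \<open>k\<close> variables set, the next clause causes a further variable to be set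
  with probability \<open>1 - k / n\<close>, and is rejected with probability \<open>k (k - 1) / (4 n (n - 1))\<close>, whatever
  the values of the set variables.  So the expected number of accepted clauses among the next
  \<open>r\<close> is a function \<open>V r k\<close>, and \<open>n - k\<close> evolves as the number of missing coupons of a coupon
  collector, which gives a closed form.  The recursion for \<open>V r k - V r (k + 1)\<close> shows that this loss
  lies in \<open>[0, 1/2]\<close>, and is positive for \<open>r, k \<ge> 1\<close>.  Hence accepting a clause is always worth setting
  one variable, and setting more is a strict loss unless no clause remains.  (For \<open>k = 0\<close> the loss
  may vanish, but the first clause forces \<open>k \<ge> 1\<close> anyway.)\<close>

section \<open>The value function of Online-Lazy: marginal losses and closed form\<close>

primrec lazy_value :: "nat \<Rightarrow> nat \<Rightarrow> nat \<Rightarrow> real" where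
  "lazy_value n 0 k = 0"
| "lazy_value n (Suc r) k =
     1 - real k * (real k - 1) / (4 * (real n * (real n - 1)))
     + (1 - real k / real n) * lazy_value n r (Suc k) + real k / real n * lazy_value n r k"

declare lazy_value.simps(2) [simp del]

text \<open>Subtracting the recursions at \<open>k\<close> and \<open>Suc k\<close> regroups the
  values at \<open>Suc k\<close>, so that the loss obeys a recursion of its own. For
  \<open>k < n\<close> its weights \<open>k / n\<close> and \<open>1 - (k + 1) / n\<close> are
  nonnegative with sum \<open>1 - 1 / n\<close>.\<close>

lemma lazy_value_diff_Suc:
  "lazy_value n (Suc r) k - lazy_value n (Suc r) (Suc k) =
    real k / (2 * (real n * (real n - 1)))
    + real k / real n * (lazy_value n r k - lazy_value n r (Suc k))
    + (1 - real (Suc k) / real n) * (lazy_value n r (Suc k) - lazy_value n r (Suc (Suc k)))"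
proof -
  define M where "M = real n * (real n - 1)"
  have "real (Suc k) * (real (Suc k) - 1) / (4 * M) - real k * (real k - 1) / (4 * M) =
      (2 * real k) / (2 * (2 * M))"
    by (simp add: diff_divide_distrib[symmetric] algebra_simps)
  also have "\<dots> = real k / (2 * M)" by (rule mult_divide_mult_cancel_left) simp
  finally show ?thesis
    unfolding lazy_value.simps M_def[symmetric] by (simp add: algebra_simps)
qed

text \<open>The weights of the loss recursion leave a deficit of \<open>1 / n\<close>, worth
  \<open>1 / (2 * n)\<close> at level \<open>1 / 2\<close>. The immediate loss is at most that since
  \<open>k \<le> n - 1\<close>, so the bound \<open>1 / 2\<close> reproduces itself.\<close>

lemma lazy_value_diff_bounds:
  assumes "n \<ge> 2" "k < n"
  shows "0 \<le> lazy_value n r k - lazy_value n r (Suc k)"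
    and "lazy_value n r k - lazy_value n r (Suc k) \<le> 1 / 2"
proof -
  have "0 \<le> lazy_value n r k - lazy_value n r (Suc k) \<and>
        lazy_value n r k - lazy_value n r (Suc k) \<le> 1 / 2"
    using assms(2)
  proof (induction r arbitrary: k)
    case 0
    then show ?case by simp
  next
    case (Suc r)
    define d where "d = lazy_value n r k - lazy_value n r (Suc k)"
    define e where "e = (1 - real (Suc k) / real n) *
                        (lazy_value n r (Suc k) - lazy_value n r (Suc (Suc k)))"
    have n: "real n \<ge> 2" using assms(1) by simp
    have d: "0 \<le> d" "d \<le> 1 / 2" using Suc unfolding d_def by auto
    have e: "0 \<le> e \<and> e \<le> (1 - real (Suc k) / real n) * (1 / 2)"
    \<comment> \<open>At \<open>Suc k = n\<close> the induction hypothesis says nothing about the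
      next difference, but its weight is zero.\<close>
    proof (cases "Suc k = n")
      case True
      then show ?thesis using n by (simp add: e_def)
    next
      case False
      then have "Suc k < n" using Suc.prems by simp
      moreover from this have "0 \<le> 1 - real (Suc k) / real n" by simp
      ultimately show ?thesis unfolding e_def
        using Suc.IH[of "Suc k"] by (auto intro!: mult_nonneg_nonneg mult_left_mono)
    qed
    have "real k / (2 * (real n * (real n - 1))) \<le> (real n - 1) / (2 * (real n * (real n - 1)))"
      using Suc.prems n by (intro divide_right_mono) auto
    also have "\<dots> = 1 / (2 * real n)" using n by (simp add: field_simps)
    finally have kn: "real k / (2 * (real n * (real n - 1))) \<le> 1 / (2 * real n)" .
    have "real k / real n * d \<le> real k / real n * (1 / 2)"
      using d by (intro mult_left_mono) auto
    then have "real k / (2 * (real n * (real n - 1))) + real k / real n * d + e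
        \<le> 1 / (2 * real n) + real k / real n * (1 / 2) + (1 - real (Suc k) / real n) * (1 / 2)"
      using kn e by linarith
    also have "\<dots> = 1 / 2" using n by (simp add: field_simps)
    finally have "real k / (2 * (real n * (real n - 1))) + real k / real n * d + e \<le> 1 / 2" .
    moreover have "0 \<le> real k / (2 * (real n * (real n - 1)))" "0 \<le> real k / real n * d"
      using n d by auto
    ultimately show ?case
      using e unfolding lazy_value_diff_Suc d_def e_def by linarith
  qed
  then show "0 \<le> lazy_value n r k - lazy_value n r (Suc k)"
    and "lazy_value n r k - lazy_value n r (Suc k) \<le> 1 / 2" by auto
qed

text \<open>Once a variable is set and a clause remains, the immediate term of the loss recursion is
  strictly positive; the other two are nonnegative.\<close>

lemma lazy_value_Suc_less:
  assumes "n \<ge> 2" "k < n" "0 < k" "0 < r"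
  shows "lazy_value n r (Suc k) < lazy_value n r k"
proof -
  obtain s where s: "r = Suc s" using assms(4) by (cases r) auto
  have "0 < real k / (2 * (real n * (real n - 1)))" using assms by simp
  moreover have "0 \<le> real k / real n * (lazy_value n s k - lazy_value n s (Suc k))"
    using lazy_value_diff_bounds[OF assms(1,2)] by simp
  moreover have "0 \<le> (1 - real (Suc k) / real n) *
      (lazy_value n s (Suc k) - lazy_value n s (Suc (Suc k)))"
  proof (cases "Suc k = n")
    case True
    then show ?thesis using assms by simp
  next
    case False
    then show ?thesis
      using assms lazy_value_diff_bounds(1)[OF assms(1), of "Suc k"] by (intro mult_nonneg_nonneg) auto
  qed
  ultimately have "0 < lazy_value n (Suc s) k - lazy_value n (Suc s) (Suc k)"
    unfolding lazy_value_diff_Suc by linarith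
  then show ?thesis using s by (simp)
qed

lemma lazy_value_antimono:
  assumes "n \<ge> 2" "k \<le> l" "l \<le> n"
  shows "lazy_value n r l \<le> lazy_value n r k"
  using assms(2,3)
proof (induction l rule: dec_induct)
  case (step l)
  then show ?case using lazy_value_diff_bounds(1)[OF assms(1), of l r] by simp
qed simp

lemma lazy_value_strict_antimono:
  assumes "n \<ge> 2" "0 < k" "k < l" "l \<le> n" "0 < r"
  shows "lazy_value n r l < lazy_value n r k"
proof -
  have "lazy_value n r l \<le> lazy_value n r (Suc k)"
    using assms by (intro lazy_value_antimono) auto
  also have "\<dots> < lazy_value n r k" using assms by (intro lazy_value_Suc_less) auto
  finally show ?thesis .
qed

text \<open>Let \<open>k\<close> grow by one with probability \<open>1 - k / n\<close>. The
  constants, \<open>n - k\<close> and \<open>(n - k) * (n - k - 1)\<close> are eigenfunctions of the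
  one-step expectation, with eigenvalues 1, \<open>1 - 1 / n\<close> and \<open>1 - 2 / n\<close>
  (factorial moments of the number of missing coupons). The acceptance probability is a combination
  of them, so summing over \<open>r\<close> steps gives geometric series.\<close>

lemma lazy_value_closed_form:
  assumes "n \<ge> 2"
  shows "lazy_value n r k = 3 / 4 * real r + (real n - real k) / 2 * (1 - (1 - 1 / real n) ^ r)
    - (real n - real k) * (real n - real k - 1) / (8 * (real n - 1)) * (1 - (1 - 2 / real n) ^ r)"
proof (induction r arbitrary: k)
  case 0
  then show ?case by simp
next
  case (Suc r)
  define x where "x = (1 - 1 / real n) ^ r"
  define y where "y = (1 - 2 / real n) ^ r"
  define p where "p = (\<lambda>k. (real n - real k) / 2)"
  define q where "q = (\<lambda>k. (real n - real k) * (real n - real k - 1) / (8 * (real n - 1)))"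
  have n: "real n \<noteq> 0" "real n - 1 \<noteq> 0" using assms by auto
  have IH: "lazy_value n r k = 3 / 4 * real r + p k * (1 - x) - q k * (1 - y)" for k
    using Suc by (simp add: p_def q_def x_def y_def)
  have p: "(1 - real k / real n) * p (Suc k) + real k / real n * p k = p k * (1 - 1 / real n)"
    using n unfolding p_def by (simp add: field_simps)
  have q: "(1 - real k / real n) * q (Suc k) + real k / real n * q k = q k * (1 - 2 / real n)"
    using n unfolding q_def by (simp add: divide_simps) (simp add: algebra_simps)
  \<comment> \<open>The rejection probability in terms of the eigenfunctions. The factors
    \<open>1 / n\<close> and \<open>2 / n\<close> are one minus the eigenvalues and cancel the
    denominators of the geometric sums.\<close>
  have const: "real k * (real k - 1) / (4 * (real n * (real n - 1))) =
      1 / 4 - (p k / real n - q k * (2 / real n))"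
    using n unfolding p_def q_def by (simp add: divide_simps) (simp add: algebra_simps)
  have "lazy_value n (Suc r) k = 1 - real k * (real k - 1) / (4 * (real n * (real n - 1)))
      + 3 / 4 * real r
      + ((1 - real k / real n) * p (Suc k) + real k / real n * p k) * (1 - x)
      - ((1 - real k / real n) * q (Suc k) + real k / real n * q k) * (1 - y)"
    unfolding lazy_value.simps IH by (simp only: algebra_simps)
  also have "\<dots> = 3 / 4 * real (Suc r) + p k * (1 - (1 - 1 / real n) * x)
      - q k * (1 - (1 - 2 / real n) * y)"
    unfolding p q const using n by (simp add: field_simps)
  finally show ?case by (simp add: p_def q_def x_def y_def)
qed

section \<open>The averaged effect of one step of Online-Lazy\<close>

text \<open>The Bellman value of a decision and the resulting assignment: immediate reward plus
  continuation value, which sees only the number of set variables. Lazy steps and the steps of other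
  algorithms are thus measured alike.\<close>

definition step_value :: "(nat \<Rightarrow> real) \<Rightarrow> bool \<times> assignment \<Rightarrow> real" where
  "step_value V p = of_bool (fst p) + V (card (dom (snd p)))"

text \<open>The choice \<open>f\<close> disappears: whichever of two unset literals is set true, the
  clause is accepted and the domain grows by one.\<close>

lemma step_value_lazy_step:
  assumes "finite (dom \<sigma>)" "i \<noteq> j"
  shows "step_value V (lazy_step f \<sigma> ((i, a), (j, b))) =
     (if \<sigma> i = Some a \<or> \<sigma> j = Some b then 1 + V (card (dom \<sigma>))
      else if i \<in> dom \<sigma> \<and> j \<in> dom \<sigma> then V (card (dom \<sigma>))
      else 1 + V (Suc (card (dom \<sigma>))))"
  using assms
  by (cases "\<sigma> i"; cases "\<sigma> j")
    (simp_all add: step_value_def lazy_step_def lit_true_def lit_false_def set_true_def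
       Let_def card_insert_if domIff)

text \<open>Over the four sign patterns the values of \<open>\<sigma>\<close> average out and only
  the indicators of its domain remain. The product \<open>s i * s j\<close> is the single rejected
  pattern when both variables are set.\<close>

lemma sum_signs_step_value_lazy:
  fixes V :: "nat \<Rightarrow> real"
  assumes "finite (dom \<sigma>)" "i \<noteq> j"
  defines "s \<equiv> \<lambda>v. of_bool (v \<in> dom \<sigma>) :: real"
  shows "(\<Sum>a\<in>UNIV. \<Sum>b\<in>UNIV. step_value V (lazy_step (f a b) \<sigma> ((i, a), (j, b)))) =
      4 + 4 * V (Suc (card (dom \<sigma>)))
      + 2 * (V (card (dom \<sigma>)) - V (Suc (card (dom \<sigma>)))) * (s i + s j) - s i * s j"
  unfolding step_value_lazy_step[OF assms(1,2)] s_def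
  by (cases "\<sigma> i"; cases "\<sigma> j") (simp_all add: UNIV_bool domIff)

text \<open>The square splits into the pairs with \<open>i < j\<close>, their mirror images and the
  diagonal. Sums over the square are easier to evaluate, as the two indices vary
  independently.\<close>

lemma sum_pairs_symmetric:
  fixes g :: "nat \<Rightarrow> nat \<Rightarrow> real"
  assumes "\<And>i j. g i j = g j i"
  shows "2 * (\<Sum>(i, j)\<in>{(i, j). 1 \<le> i \<and> i < j \<and> j \<le> n}. g i j) =
     (\<Sum>i=1..n. \<Sum>j=1..n. g i j) - (\<Sum>i=1..n. g i i)"
proof -
  let ?P = "{(i, j). 1 \<le> i \<and> i < j \<and> j \<le> n}"
  have fin: "finite ?P" by (rule finite_subset[of _ "{1..n} \<times> {1..n}"]) auto
  have swap: "(\<Sum>(i, j)\<in>prod.swap ` ?P. g i j) = (\<Sum>(i, j)\<in>?P. g i j)"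
    by (subst sum.reindex) (auto simp: case_prod_beta assms intro!: sum.cong)
  have diag: "(\<Sum>(i, j)\<in>(\<lambda>i. (i, i)) ` {1..n}. g i j) = (\<Sum>i=1..n. g i i)"
    by (subst sum.reindex) (auto simp: inj_on_def)
  have "{1..n} \<times> {1..n} = (?P \<union> prod.swap ` ?P) \<union> (\<lambda>i. (i, i)) ` {1..n}"
    by (auto simp: image_iff)
  then have "(\<Sum>i=1..n. \<Sum>j=1..n. g i j) =
      (\<Sum>(i, j)\<in>(?P \<union> prod.swap ` ?P) \<union> (\<lambda>i. (i, i)) ` {1..n}. g i j)"
    by (simp add: sum.cartesian_product)
  also have "\<dots> = 2 * (\<Sum>(i, j)\<in>?P. g i j) + (\<Sum>i=1..n. g i i)"
  proof -
    have "(\<Sum>(i, j)\<in>?P \<union> prod.swap ` ?P. g i j) = 2 * (\<Sum>(i, j)\<in>?P. g i j)"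
      using fin by (subst sum.union_disjoint) (auto simp only: swap finite_imageI, auto)
    moreover have "(?P \<union> prod.swap ` ?P) \<inter> (\<lambda>i. (i, i)) ` {1..n} = {}" by auto
    ultimately show ?thesis
      using fin by (subst sum.union_disjoint) (auto simp only: diag finite_imageI finite_UnI finite_atLeastAtMost)
  qed
  finally show ?thesis by simp
qed

lemma sum_clauses:
  "(\<Sum>c\<in>clauses n. h c) =
   (\<Sum>(i, j)\<in>{(i, j). 1 \<le> i \<and> i < j \<and> j \<le> n}. \<Sum>a\<in>UNIV. \<Sum>b\<in>UNIV. h ((i, a), (j, b)))"
proof -
  let ?P = "{(i, j). 1 \<le> i \<and> i < j \<and> j \<le> n}"
  have "(\<Sum>c\<in>clauses n. h c) =
      (\<Sum>(p, q)\<in>?P \<times> (UNIV \<times> UNIV). h ((fst p, fst q), (snd p, snd q)))"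
    by (rule sum.reindex_bij_witness[of _ "\<lambda>((i, j), (a, b)). ((i, a), (j, b))"
          "\<lambda>((i, a), (j, b)). ((i, j), (a, b))"]) (auto simp: clauses_def)
  also have "\<dots> = (\<Sum>p\<in>?P. \<Sum>q\<in>UNIV \<times> UNIV. h ((fst p, fst q), (snd p, snd q)))"
    by (rule sum.cartesian_product[symmetric])
  also have "\<dots> = (\<Sum>p\<in>?P. \<Sum>a\<in>UNIV. \<Sum>b\<in>UNIV. h ((fst p, a), (snd p, b)))"
    by (rule sum.cong[OF refl], subst sum.cartesian_product) (simp add: case_prod_beta)
  finally show ?thesis by (simp only: case_prod_unfold)
qed

text \<open>The Bellman equation of Online-Lazy, which ties the abstract recursion of
  \<open>lazy_value\<close> to actual clauses.\<close>

lemma sum_clauses_step_value_lazy: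
  assumes "n \<ge> 2" "dom \<sigma> \<subseteq> {1..n}"
  shows "(\<Sum>c\<in>clauses n. step_value (lazy_value n r) (lazy_step (f c) \<sigma> c)) =
         real (card (clauses n)) * lazy_value n (Suc r) (card (dom \<sigma>))"
proof -
  define k where "k = card (dom \<sigma>)"
  define s where "s = (\<lambda>v. of_bool (v \<in> dom \<sigma>) :: real)"
  define g where "g = (\<lambda>i j. 4 + 4 * lazy_value n r (Suc k)
      + 2 * (lazy_value n r k - lazy_value n r (Suc k)) * (s i + s j) - s i * s j)"
  have fin: "finite (dom \<sigma>)" using assms(2) finite_subset by blast
  have "(\<Sum>c\<in>clauses n. step_value (lazy_value n r) (lazy_step (f c) \<sigma> c)) =
        (\<Sum>(i, j)\<in>{(i, j). 1 \<le> i \<and> i < j \<and> j \<le> n}. g i j)"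
    unfolding sum_clauses
  proof (rule sum.cong[OF refl], clarify)
    fix i j :: nat assume "i < j"
    then show "(\<Sum>a\<in>UNIV. \<Sum>b\<in>UNIV. step_value (lazy_value n r)
          (lazy_step (f ((i, a), (j, b))) \<sigma> ((i, a), (j, b)))) = g i j"
      unfolding g_def k_def s_def using fin by (intro sum_signs_step_value_lazy) auto
  qed
  moreover have sum_s: "(\<Sum>i=1..n. s i) = real k"
    using assms(2) by (simp add: s_def k_def Int_absorb1)
  \<comment> \<open>Indicators are idempotent, so the product term contributes \<open>k * k\<close>
    over the square and \<open>k\<close> over the diagonal; the difference is the
    \<open>k * (k - 1)\<close> of the rejection probability.\<close>
  have s_sq: "s i * s i = s i" for i by (simp add: s_def)
  have "(\<Sum>i=1..n. \<Sum>j=1..n. g i j) = real n * (real n * (4 + 4 * lazy_value n r (Suc k)))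
      + 4 * (lazy_value n r k - lazy_value n r (Suc k)) * real n * real k - real k * real k"
    by (simp add: g_def sum.distrib sum_subtractf sum_distrib_left[symmetric]
        sum_distrib_right[symmetric] sum_s algebra_simps del: One_nat_def)
  moreover have "(\<Sum>i=1..n. g i i) = real n * (4 + 4 * lazy_value n r (Suc k))
      + 4 * (lazy_value n r k - lazy_value n r (Suc k)) * real k - real k"
    by (simp add: g_def sum.distrib sum_subtractf sum_distrib_left[symmetric]
        sum_distrib_right[symmetric] sum_s s_sq algebra_simps del: One_nat_def)
  moreover have "2 * (\<Sum>(i, j)\<in>{(i, j). 1 \<le> i \<and> i < j \<and> j \<le> n}. g i j) =
     (\<Sum>i=1..n. \<Sum>j=1..n. g i j) - (\<Sum>i=1..n. g i i)"
    by (rule sum_pairs_symmetric) (simp add: g_def algebra_simps)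
  \<comment> \<open>The factor 2 matches the doubled pair sum; there are
    \<open>2 * n * (n - 1)\<close> clauses.\<close>
  moreover have "2 * (real (card (clauses n)) * lazy_value n (Suc r) k) =
      4 * (real n * (real n - 1)) - real k * (real k - 1)
      + 4 * (real n - 1) * (real n - real k) * lazy_value n r (Suc k)
      + 4 * (real n - 1) * real k * lazy_value n r k"
  proof -
    have "2 * (n choose 2) = n * (n - 1)" by (cases n) (simp_all add: choose_two)
    then have "real (2 * (n choose 2)) = real (n * (n - 1))" by (rule arg_cong)
    moreover have "real (n - 1) = real n - 1" using assms(1) by simp
    ultimately have card: "real (card (clauses n)) = 2 * (real n * (real n - 1))"
      by (simp add: card_clauses)
    define M where "M = real n * (real n - 1)"
    have "real n \<noteq> 0" "M \<noteq> 0" using assms(1) by (auto simp: M_def)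
    then have MK: "4 * (M * (real k * (real k - 1) / (4 * M))) = real k * (real k - 1)" by simp
    have Mk: "M * (real k / real n) = (real n - 1) * real k"
      using \<open>real n \<noteq> 0\<close> by (simp add: M_def)
    have Mnk: "M * (1 - real k / real n) = (real n - 1) * (real n - real k)"
      unfolding right_diff_distrib Mk by (simp add: M_def)
    have expand: "2 * (2 * M * (1 - a + p * v + q * w)) =
        4 * M - 4 * (M * a) + 4 * (M * p) * v + 4 * (M * q) * w" for a p v q w :: real
      by (simp add: algebra_simps)
    show ?thesis
      unfolding card lazy_value.simps M_def[symmetric] expand MK Mk Mnk by (simp add: algebra_simps)
  qed
  ultimately have "2 * (\<Sum>c\<in>clauses n. step_value (lazy_value n r) (lazy_step (f c) \<sigma> c)) =
      2 * (real (card (clauses n)) * lazy_value n (Suc r) k)"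
    by (simp add: algebra_simps)
  then show ?thesis unfolding k_def by simp
qed

section \<open>One-step comparison of an arbitrary algorithm with Online-Lazy\<close>

text \<open>Extra set variables never raise the continuation value, and rejecting an acceptable
  clause costs 1 while a variable saved is worth at most \<open>1 / 2\<close>. Equality always fixes
  the decision, but the assignment only if a clause remains: \<open>lazy_value n 0\<close> is
  identically zero.\<close>

lemma online_step_le_lazy_step:
  assumes n: "n \<ge> 2" and c: "c \<in> clauses n"
    and \<tau>: "dom \<tau> \<subseteq> {1..n}" "\<sigma> \<subseteq>\<^sub>m \<tau>" "a \<longrightarrow> satisfies \<tau> c"
  shows "step_value (lazy_value n r) (a, \<tau>) \<le> step_value (lazy_value n r) (lazy_step f \<sigma> c)"
    and "step_value (lazy_value n r) (a, \<tau>) = step_value (lazy_value n r) (lazy_step f \<sigma> c) \<Longrightarrow>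
           a = fst (lazy_step f \<sigma> c)"
    and "step_value (lazy_value n r) (a, \<tau>) = step_value (lazy_value n r) (lazy_step f \<sigma> c) \<Longrightarrow>
           0 < r \<Longrightarrow> \<tau> \<in> {snd (lazy_step True \<sigma> c), snd (lazy_step False \<sigma> c)}"
proof -
  obtain i x j y where c_eq: "c = ((i, x), (j, y))" and ij: "1 \<le> i" "i < j" "j \<le> n"
    using c unfolding clauses_def by auto
  let ?k = "card (dom \<sigma>)" and ?l = "card (dom \<tau>)"
  let ?V = "lazy_value n r"
  let ?lhs = "of_bool a + ?V ?l" and ?rhs = "step_value ?V (lazy_step f \<sigma> c)"
  have fin: "finite (dom \<tau>)" using \<tau>(1) finite_subset by blast
  have sub: "dom \<sigma> \<subseteq> dom \<tau>" using \<tau>(2) by (rule map_le_implies_dom_le)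
  then have fin': "finite (dom \<sigma>)" using fin finite_subset by blast
  have kl: "?k \<le> ?l" using sub fin by (rule card_mono[rotated])
  have ln: "?l \<le> n" using card_mono[OF _ \<tau>(1)] by simp
  have eq_if_card: "\<tau> = \<rho>" if "\<rho> \<subseteq>\<^sub>m \<tau>" "card (dom \<rho>) = ?l" for \<rho>
    using that fin map_le_implies_dom_le[of \<rho> \<tau>] card_subset_eq[of "dom \<tau>" "dom \<rho>"]
    by (metis map_le_antisym map_le_def)
  have VV: "?V ?l \<le> ?V ?k" using n kl ln by (rule lazy_value_antimono)
  have agree_\<sigma>: "\<tau> v = Some b" if "\<sigma> v = Some b" for v b
    using \<tau>(2) that unfolding map_le_def by (metis domI)
  \<comment> \<open>The strict decrease of \<open>lazy_value\<close> starts at one set variable,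
    hence the nonempty domain. It is available where a literal of the clause already has a
    value.\<close>
  have stay: "\<tau> = \<sigma>" if "?V ?l = ?V ?k" "0 < r" "dom \<sigma> \<noteq> {}"
  proof -
    have "0 < ?k" using that(3) fin' by (simp add: card_gt_0_iff)
    then have "?l = ?k"
      using lazy_value_strict_antimono[OF n, of ?k ?l r] kl ln that by force
    then show ?thesis using eq_if_card[of \<sigma>] \<tau>(2) by simp
  qed
  consider (sat) "lit_true \<sigma> (i, x) \<or> lit_true \<sigma> (j, y)"
    | (false) "lit_false \<sigma> (i, x)" "lit_false \<sigma> (j, y)"
    | (free) "\<not> lit_true \<sigma> (i, x)" "\<not> lit_true \<sigma> (j, y)"
        "\<not> (lit_false \<sigma> (i, x) \<and> lit_false \<sigma> (j, y))"
    by blast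
  then have "?lhs \<le> ?rhs \<and> (?lhs = ?rhs \<longrightarrow> a = fst (lazy_step f \<sigma> c) \<and>
      (0 < r \<longrightarrow> \<tau> \<in> {snd (lazy_step True \<sigma> c), snd (lazy_step False \<sigma> c)}))"
  proof cases
    case sat
    then have step: "lazy_step f' \<sigma> c = (True, \<sigma>)" for f'
      by (auto simp: c_eq lazy_step_def)
    have "dom \<sigma> \<noteq> {}" using sat by (auto simp: lit_true_def)
    then show ?thesis using VV stay unfolding step step_value_def by (cases a) auto
  next
    case false
    then have step: "lazy_step f' \<sigma> c = (False, \<sigma>)" for f'
      by (auto simp: c_eq lazy_step_def lit_true_def lit_false_def)
    have "dom \<sigma> \<noteq> {}" using false by (auto simp: lit_false_def)
    \<comment> \<open>Values never change, so a clause false under \<open>\<sigma>\<close> stays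
      false under every extension and must be rejected.\<close>
    moreover have "\<not> satisfies \<tau> c"
      using false agree_\<sigma> by (auto simp: c_eq satisfies_def lit_true_def lit_false_def)
    then have "\<not> a" using \<tau>(3) by blast
    ultimately show ?thesis using VV stay unfolding step step_value_def by auto
  next
    case free
    define \<rho> where "\<rho> = (\<lambda>f'. snd (lazy_step f' \<sigma> c))"
    have acc: "fst (lazy_step f' \<sigma> c)" for f'
      using free by (auto simp: c_eq lazy_step_def Let_def)
    have card_\<rho>: "card (dom (\<rho> f')) = Suc ?k" for f'
      using free fin' unfolding \<rho>_def c_eq
      by (cases "\<sigma> i"; cases "\<sigma> j")
        (auto simp: lazy_step_def lit_true_def lit_false_def set_true_def Let_def card_insert_if domIff)
    have rhs: "?rhs = 1 + ?V (Suc ?k)" using acc card_\<rho> by (simp add: step_value_def \<rho>_def)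
    have "?k < n"
    proof -
      have "dom \<sigma> \<noteq> {1..n}"
      proof
        assume "dom \<sigma> = {1..n}"
        then have "i \<in> dom \<sigma>" "j \<in> dom \<sigma>" using ij by auto
        then show False using free by (auto simp: lit_true_def lit_false_def)
      qed
      then have "dom \<sigma> \<subset> {1..n}" using sub \<tau>(1) by blast
      from psubset_card_mono[OF _ this] show ?thesis by simp
    qed
    then have gain: "?V ?k - ?V (Suc ?k) \<le> 1 / 2" using n lazy_value_diff_bounds(2) by blast
    show ?thesis
    proof (cases a)
      \<comment> \<open>Rejecting leaves a gap of at least \<open>1 / 2\<close>, so equality is
        impossible here.\<close>
      case False
      then show ?thesis using gain VV unfolding rhs by simp
    next
      case True
      then have "satisfies \<tau> c" using \<tau>(3) by blast
      then consider "\<tau> i = Some x" | "\<tau> j = Some y"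
        by (auto simp: c_eq satisfies_def lit_true_def)
      \<comment> \<open>The witness is the choice of a literal that \<open>\<tau>\<close> satisfies.
        If only one literal is free, both choices give the same successor.\<close>
      then have "\<exists>f'. \<rho> f' \<subseteq>\<^sub>m \<tau>"
      proof cases
        case 1
        have "\<rho> True \<subseteq>\<^sub>m \<tau>"
          using free 1 agree_\<sigma> unfolding \<rho>_def c_eq map_le_def
          by (auto simp: lazy_step_def lit_true_def lit_false_def set_true_def Let_def)
        then show ?thesis by blast
      next
        case 2
        have "\<rho> False \<subseteq>\<^sub>m \<tau>"
          using free 2 agree_\<sigma> unfolding \<rho>_def c_eq map_le_def
          by (auto simp: lazy_step_def lit_true_def lit_false_def set_true_def Let_def)
        then show ?thesis by blast
      qed
      then obtain f' where f': "\<rho> f' \<subseteq>\<^sub>m \<tau>" ..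
      then have kl': "Suc ?k \<le> ?l"
        using card_mono[OF fin map_le_implies_dom_le[OF f']] card_\<rho> by simp
      then have VV': "?V ?l \<le> ?V (Suc ?k)" using n ln lazy_value_antimono by blast
      moreover have "\<tau> = \<rho> f'" if "?V ?l = ?V (Suc ?k)" "0 < r"
      proof -
        \<comment> \<open>Strictness is used from \<open>Suc ?k\<close>, which is positive even if
          \<open>\<sigma>\<close> is empty, as at the first clause.\<close>
        have "?l = Suc ?k"
          using lazy_value_strict_antimono[OF n, of "Suc ?k" ?l r] kl' ln that by force
        then show ?thesis using eq_if_card[OF f'] card_\<rho> by simp
      qed
      moreover have "\<rho> f' \<in> {\<rho> True, \<rho> False}" by (cases f') auto
      ultimately show ?thesis using True acc unfolding rhs \<rho>_def by auto
    qed
  qed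
  note main = this
  have lhs: "step_value ?V (a, \<tau>) = ?lhs" by (simp add: step_value_def)
  show "step_value ?V (a, \<tau>) \<le> ?rhs"
    and "step_value ?V (a, \<tau>) = ?rhs \<Longrightarrow> a = fst (lazy_step f \<sigma> c)"
    and "step_value ?V (a, \<tau>) = ?rhs \<Longrightarrow> 0 < r \<Longrightarrow>
           \<tau> \<in> {snd (lazy_step True \<sigma> c), snd (lazy_step False \<sigma> c)}"
    using main unfolding lhs by blast+
qed

section \<open>Expected acceptances as a backward recursion over histories\<close>

lemma clauses_nonempty: "n \<ge> 2 \<Longrightarrow> clauses n \<noteq> {}"
  using card_clauses[of n] by (auto simp: zero_less_binomial_iff)

text \<open>The conditional expectation of the number of acceptances by \<open>A\<close> among the
  next \<open>r\<close> clauses, given \<open>h\<close>. It is indexed by histories because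
  \<open>A\<close> may use all of \<open>h\<close>, not only its current assignment.\<close>

primrec history_value :: "nat \<Rightarrow> online_algorithm \<Rightarrow> nat \<Rightarrow> clause list \<Rightarrow> real" where
  "history_value n A 0 h = 0"
| "history_value n A (Suc r) h =
     (\<Sum>c\<in>clauses n. of_bool (accepts A (h @ [c])) + history_value n A r (h @ [c]))
       / real (card (clauses n))"

declare history_value.simps(2) [simp del]

text \<open>Position 1 is \<open>c\<close> itself; every later position is the \<open>Suc\<close> of
  a position in \<open>cs\<close>, with \<open>c\<close> moved into the history.\<close>

lemma card_accepted_Cons:
  "card {i \<in> {1..length (c # cs)}. accepts A (h @ take i (c # cs))} =
     of_bool (accepts A (h @ [c])) + card {i \<in> {1..length cs}. accepts A ((h @ [c]) @ take i cs)}"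
proof -
  let ?S = "{i \<in> {1..length cs}. accepts A ((h @ [c]) @ take i cs)}"
  let ?T = "if accepts A (h @ [c]) then {1::nat} else {}"
  have "{i \<in> {1..length (c # cs)}. accepts A (h @ take i (c # cs))} = ?T \<union> Suc ` ?S"
  proof (rule set_eqI)
    fix i
    show "i \<in> {i \<in> {1..length (c # cs)}. accepts A (h @ take i (c # cs))} \<longleftrightarrow> i \<in> ?T \<union> Suc ` ?S"
      by (cases i rule: old.nat.exhaust; cases "i = 1") auto
  qed
  moreover have "card (?T \<union> Suc ` ?S) = card ?T + card (Suc ` ?S)"
    by (rule card_Un_disjoint) auto
  moreover have "card (Suc ` ?S) = card ?S" by (rule card_image) simp
  ultimately show ?thesis by simp
qed

lemma expectation_accepted_from_history:
  assumes "n \<ge> 2"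
  shows "measure_pmf.expectation (random_formula n r)
      (\<lambda>cs. real (card {i \<in> {1..length cs}. accepts A (h @ take i cs)})) = history_value n A r h"
proof (induction r arbitrary: h)
  case 0
  then show ?case by (simp add: random_formula_def)
next
  case (Suc r)
  \<comment> \<open>Finite support makes every integrand below integrable.\<close>
  have fin: "finite (set_pmf (random_formula n r))"
    unfolding random_formula_def
    using finite_lists_length_eq[OF finite_clauses[of n], of r] clauses_nonempty[OF assms]
    by (auto simp: set_replicate_pmf set_pmf_of_set finite_clauses lists_eq_set)
  let ?N = "\<lambda>h cs. real (card {i \<in> {1..length cs}. accepts A (h @ take i cs)})"
  have step: "random_formula n (Suc r) =
      pmf_of_set (clauses n) \<bind> (\<lambda>c. map_pmf ((#) c) (random_formula n r))"
    by (simp add: random_formula_def map_pmf_def)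
  have "measure_pmf.expectation (map_pmf ((#) c) (random_formula n r)) (?N h) =
      of_bool (accepts A (h @ [c])) + history_value n A r (h @ [c])" for c
  proof -
    have "measure_pmf.expectation (map_pmf ((#) c) (random_formula n r)) (?N h) =
        measure_pmf.expectation (random_formula n r)
          (\<lambda>cs. of_bool (accepts A (h @ [c])) + ?N (h @ [c]) cs)"
      by (simp only: integral_map_pmf card_accepted_Cons of_nat_add of_nat_of_bool)
    also have "\<dots> = of_bool (accepts A (h @ [c])) + measure_pmf.expectation (random_formula n r) (?N (h @ [c]))"
      by (subst Bochner_Integration.integral_add)
        (auto intro: integrable_measure_pmf_finite[OF fin] simp del: append_assoc)
    finally show ?thesis unfolding Suc .
  qed
  then show ?case
    unfolding step using clauses_nonempty[OF assms] fin
    by (subst pmf_expectation_bind_pmf_of_set)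
      (simp_all add: finite_clauses history_value.simps(2) sum_distrib_left divide_inverse mult.commute)
qed

lemma expected_accepted_eq_history_value:
  "n \<ge> 2 \<Longrightarrow> expected_accepted n m A = history_value n A m []"
  using expectation_accepted_from_history[of n m A "[]"]
  by (simp add: expected_accepted_def num_accepted_def)

section \<open>The upper bound for all algorithms and the optimality of Online-Lazy\<close>

lemma online_I_dom:
  assumes "online_I n m A" "set h \<subseteq> clauses n" "length h \<le> m"
  shows "dom (assigns A h) \<subseteq> {1..n}"
proof (cases h rule: rev_cases)
  case Nil
  then show ?thesis using assms(1) by (simp add: online_I_def)
next
  case (snoc h' c)
  then show ?thesis using assms unfolding online_I_def by blast
qed

lemma online_I_step_le:
  fixes r :: nat
  assumes "n \<ge> 2" "online_I n m A" "set h \<subseteq> clauses n" "length h < m" "c \<in> clauses n"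
  defines "V \<equiv> lazy_value n r"
  shows "step_value V (accepts A (h @ [c]), assigns A (h @ [c])) \<le>
           step_value V (lazy_step f (assigns A h) c)"
    and "step_value V (accepts A (h @ [c]), assigns A (h @ [c])) =
           step_value V (lazy_step f (assigns A h) c) \<Longrightarrow>
         accepts A (h @ [c]) = fst (lazy_step f (assigns A h) c)"
    and "step_value V (accepts A (h @ [c]), assigns A (h @ [c])) =
           step_value V (lazy_step f (assigns A h) c) \<Longrightarrow> 0 < r \<Longrightarrow>
         assigns A (h @ [c]) \<in>
           {snd (lazy_step True (assigns A h) c), snd (lazy_step False (assigns A h) c)}"
proof -
  have "set (h @ [c]) \<subseteq> clauses n \<and> length (h @ [c]) \<le> m" using assms by auto
  then have *: "dom (assigns A (h @ [c])) \<subseteq> {1..n}" "assigns A h \<subseteq>\<^sub>m assigns A (h @ [c])"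
    "accepts A (h @ [c]) \<longrightarrow> satisfies (assigns A (h @ [c])) c"
    using assms(2) unfolding online_I_def by blast+
  show "step_value V (accepts A (h @ [c]), assigns A (h @ [c])) \<le>
           step_value V (lazy_step f (assigns A h) c)"
    and "step_value V (accepts A (h @ [c]), assigns A (h @ [c])) =
           step_value V (lazy_step f (assigns A h) c) \<Longrightarrow>
         accepts A (h @ [c]) = fst (lazy_step f (assigns A h) c)"
    and "step_value V (accepts A (h @ [c]), assigns A (h @ [c])) =
           step_value V (lazy_step f (assigns A h) c) \<Longrightarrow> 0 < r \<Longrightarrow>
         assigns A (h @ [c]) \<in>
           {snd (lazy_step True (assigns A h) c), snd (lazy_step False (assigns A h) c)}"
    unfolding V_def by (fact online_step_le_lazy_step[OF assms(1,5) *])+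
qed

text \<open>Backward induction: the continuation is worth at most \<open>lazy_value\<close> at the
  assignment reached by \<open>A\<close>, the one-step comparison replaces that step by a lazy one,
  and the Bellman equation sums the lazy steps.\<close>

lemma history_value_le:
  assumes "n \<ge> 2" "online_I n m A" "set h \<subseteq> clauses n" "length h + r \<le> m"
  shows "history_value n A r h \<le> lazy_value n r (card (dom (assigns A h)))"
  using assms(3,4)
proof (induction r arbitrary: h)
  case 0
  then show ?case by simp
next
  case (Suc r)
  have "(\<Sum>c\<in>clauses n. of_bool (accepts A (h @ [c])) + history_value n A r (h @ [c])) \<le>
      (\<Sum>c\<in>clauses n. step_value (lazy_value n r) (lazy_step True (assigns A h) c))"
  proof (rule sum_mono)
    fix c assume c: "c \<in> clauses n"
    have "history_value n A r (h @ [c]) \<le> lazy_value n r (card (dom (assigns A (h @ [c]))))"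
      using Suc.prems c by (intro Suc.IH) auto
    moreover have "step_value (lazy_value n r) (accepts A (h @ [c]), assigns A (h @ [c])) \<le>
        step_value (lazy_value n r) (lazy_step True (assigns A h) c)"
      using Suc.prems c assms by (intro online_I_step_le(1)) auto
    ultimately show "of_bool (accepts A (h @ [c])) + history_value n A r (h @ [c]) \<le>
        step_value (lazy_value n r) (lazy_step True (assigns A h) c)"
      by (simp add: step_value_def)
  qed
  also have "\<dots> = real (card (clauses n)) * lazy_value n (Suc r) (card (dom (assigns A h)))"
    using assms Suc.prems by (intro sum_clauses_step_value_lazy online_I_dom) auto
  finally show ?case
    using clauses_nonempty[OF assms(1)] finite_clauses[of n] unfolding history_value.simps
    by (simp add: divide_le_eq card_gt_0_iff mult.commute)
qed

lemma
  accepts_online_lazy_snoc: "accepts (online_lazy \<kappa>) (h @ [c]) =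
      fst (lazy_step (\<kappa> (h @ [c])) (assigns (online_lazy \<kappa>) h) c)"
  and assigns_online_lazy_snoc: "assigns (online_lazy \<kappa>) (h @ [c]) =
      snd (lazy_step (\<kappa> (h @ [c])) (assigns (online_lazy \<kappa>) h) c)"
  using online_lazy_snoc[of \<kappa> h c] by (metis fst_conv snd_conv)+

lemma online_I_online_lazy: "online_I n m (online_lazy \<kappa>)"
proof -
  let ?A = "online_lazy \<kappa>"
  have snd_step: "snd (lazy_step f \<sigma> c) \<in> {\<sigma>, set_true \<sigma> (fst c), set_true \<sigma> (snd c)}" for f \<sigma> c
    by (simp add: lazy_step_def Let_def)
  have dom: "dom (snd (lazy_step f \<sigma> c)) \<subseteq> {1..n}" if "dom \<sigma> \<subseteq> {1..n}" "c \<in> clauses n" for f \<sigma> c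
  proof -
    have "dom (snd (lazy_step f \<sigma> c)) \<subseteq> insert (fst (fst c)) (insert (fst (snd c)) (dom \<sigma>))"
      using snd_step[of f \<sigma> c] by (auto simp: set_true_def)
    moreover have "fst (fst c) \<in> {1..n}" "fst (snd c) \<in> {1..n}"
      using that(2) by (auto simp: clauses_def)
    ultimately show ?thesis using that(1) by blast
  qed
  have le: "\<sigma> \<subseteq>\<^sub>m snd (lazy_step f \<sigma> c)" if "c \<in> clauses n" for f \<sigma> c
    using that
    by (auto simp: lazy_step_def Let_def set_true_def clauses_def map_le_def
        lit_true_def lit_false_def)
  have sat: "satisfies (snd (lazy_step f \<sigma> c)) c" if "fst (lazy_step f \<sigma> c)" for f \<sigma> c
    using that
    by (auto simp: lazy_step_def Let_def set_true_def satisfies_def lit_true_def split: if_splits)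
  have "dom (assigns ?A h) \<subseteq> {1..n}" if "set h \<subseteq> clauses n" for h
    using that
  proof (induction h rule: rev_induct)
    case Nil
    then show ?case by (simp add: online_lazy_Nil)
  next
    case (snoc c h)
    then show ?case unfolding assigns_online_lazy_snoc by (intro dom) auto
  qed
  then show ?thesis
    unfolding online_I_def accepts_online_lazy_snoc assigns_online_lazy_snoc using dom le sat by (auto simp: online_lazy_Nil)
qed

text \<open>The backward induction again, now with equalities, because each step of
  \<open>online_lazy \<kappa>\<close> is a lazy step.\<close>

lemma history_value_online_lazy:
  assumes "n \<ge> 2" "set h \<subseteq> clauses n"
  shows "history_value n (online_lazy \<kappa>) r h =
           lazy_value n r (card (dom (assigns (online_lazy \<kappa>) h)))"
  using assms(2)
proof (induction r arbitrary: h)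
  case 0
  then show ?case by simp
next
  case (Suc r)
  let ?A = "online_lazy \<kappa>"
  have "(\<Sum>c\<in>clauses n. of_bool (accepts ?A (h @ [c])) + history_value n ?A r (h @ [c])) =
      (\<Sum>c\<in>clauses n. step_value (lazy_value n r) (lazy_step (\<kappa> (h @ [c])) (assigns ?A h) c))"
  proof (rule sum.cong[OF refl])
    fix c assume "c \<in> clauses n"
    then have "history_value n ?A r (h @ [c]) = lazy_value n r (card (dom (assigns ?A (h @ [c]))))"
      using Suc.prems by (intro Suc.IH) auto
    then show "of_bool (accepts ?A (h @ [c])) + history_value n ?A r (h @ [c]) =
        step_value (lazy_value n r) (lazy_step (\<kappa> (h @ [c])) (assigns ?A h) c)"
      unfolding online_lazy_snoc[symmetric] by (simp add: step_value_def)
  qed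
  also have "\<dots> = real (card (clauses n)) * lazy_value n (Suc r) (card (dom (assigns ?A h)))"
    using assms(1) Suc.prems
    by (intro sum_clauses_step_value_lazy online_I_dom[OF online_I_online_lazy]) auto
  finally show ?case
    using clauses_nonempty[OF assms(1)] finite_clauses[of n] unfolding history_value.simps
    by (simp)
qed

lemma expected_accepted_online_lazy:
  "n \<ge> 2 \<Longrightarrow> expected_accepted n m (online_lazy \<kappa>) = lazy_value n m 0"
  by (simp add: expected_accepted_eq_history_value history_value_online_lazy online_lazy_Nil)

lemma expected_accepted_le:
  "n \<ge> 2 \<Longrightarrow> online_I n m A \<Longrightarrow> expected_accepted n m A \<le> lazy_value n m 0"
  using history_value_le[of n m A "[]" m]
  by (simp add: expected_accepted_eq_history_value online_I_def)

lemma optimal_online_lazy: "n \<ge> 2 \<Longrightarrow> optimal_online_I n m (online_lazy \<kappa>)"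
  by (simp add: optimal_online_I_def online_I_online_lazy expected_accepted_online_lazy
      expected_accepted_le)

lemma f_OI_eq_lazy_value:
  assumes "n \<ge> 2"
  shows "f_OI n m = lazy_value n m 0"
proof -
  have "f_OI n m = expected_accepted n m (online_lazy (\<lambda>_. True))"
    by (rule f_OI_eq_optimal[OF optimal_online_lazy[OF assms]])
  then show ?thesis by (simp only: expected_accepted_online_lazy[OF assms])
qed

section \<open>Uniqueness up to the arbitrary choice\<close>

text \<open>Termwise inequalities between finite sums with equal totals are equalities. For each
  clause, the value of the step made by \<open>A\<close> lies between the two terms, so both
  inequalities used in the upper bound are tight.\<close>

lemma history_value_maximal_step:
  assumes "n \<ge> 2" "online_I n m A" "set h \<subseteq> clauses n" "length h + Suc r \<le> m" "c \<in> clauses n"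
    and max: "history_value n A (Suc r) h = lazy_value n (Suc r) (card (dom (assigns A h)))"
  shows "history_value n A r (h @ [c]) = lazy_value n r (card (dom (assigns A (h @ [c]))))"
    and "step_value (lazy_value n r) (accepts A (h @ [c]), assigns A (h @ [c])) =
           step_value (lazy_value n r) (lazy_step f (assigns A h) c)"
proof -
  let ?V = "lazy_value n r"
  let ?v = "\<lambda>c. of_bool (accepts A (h @ [c])) + history_value n A r (h @ [c])"
  let ?w = "\<lambda>c. step_value ?V (lazy_step f (assigns A h) c)"
  have le: "history_value n A r (h @ [c]) \<le> ?V (card (dom (assigns A (h @ [c]))))"
    "step_value ?V (accepts A (h @ [c]), assigns A (h @ [c])) \<le> ?w c" if "c \<in> clauses n" for c
    using assms(1-4) that by (auto intro!: history_value_le online_I_step_le(1))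
  then have le': "?v c \<le> ?w c" if "c \<in> clauses n" for c
    using le[OF that] by (simp add: step_value_def)
  have "sum ?w (clauses n) = real (card (clauses n)) * lazy_value n (Suc r) (card (dom (assigns A h)))"
    using assms(1-4) by (intro sum_clauses_step_value_lazy online_I_dom) auto
  also have "\<dots> = sum ?v (clauses n)"
    using clauses_nonempty[OF assms(1)] finite_clauses[of n]
    unfolding max[symmetric] history_value.simps by simp
  finally have "?v c = ?w c"
    using sum_mono_inv[of ?v "clauses n" ?w c] le' assms(5) finite_clauses by simp
  then show "history_value n A r (h @ [c]) = ?V (card (dom (assigns A (h @ [c]))))"
    and "step_value ?V (accepts A (h @ [c]), assigns A (h @ [c])) = ?w c"
    using le[OF assms(5)] by (auto simp: step_value_def)
qed

text \<open>Every clause carries positive weight, so an optimum at the empty history leaves no slack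
  at any later history.\<close>

lemma history_value_maximal:
  assumes "n \<ge> 2" "online_I n m A" "expected_accepted n m A = lazy_value n m 0"
    and "set h \<subseteq> clauses n" "length h \<le> m"
  shows "history_value n A (m - length h) h =
           lazy_value n (m - length h) (card (dom (assigns A h)))"
  using assms(4,5)
proof (induction h rule: rev_induct)
  case Nil
  then show ?case
    using assms(2,3) by (simp add: expected_accepted_eq_history_value[OF assms(1)] online_I_def)
next
  case (snoc c h)
  \<comment> \<open>Natural subtraction is safe here, since \<open>h @ [c]\<close> has length at
    most \<open>m\<close>.\<close>
  then have "m - length h = Suc (m - length (h @ [c]))" by simp
  then have "history_value n A (Suc (m - length (h @ [c]))) h =
      lazy_value n (Suc (m - length (h @ [c]))) (card (dom (assigns A h)))"
    using snoc by simp
  then show ?case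
    using snoc.prems assms(1,2) by (intro history_value_maximal_step(1)) auto
qed

lemma optimal_agrees_online_lazy:
  assumes n: "n \<ge> 2" and opt: "optimal_online_I n m A"
  shows "\<exists>\<kappa>. agree n m A (online_lazy \<kappa>)"
proof -
  have A: "online_I n m A" using opt by (simp add: optimal_online_I_def)
  have val: "expected_accepted n m A = lazy_value n m 0"
    using opt expected_accepted_le[OF n A] online_I_online_lazy
      expected_accepted_online_lazy[OF n, of m "\<lambda>_. True"]
    unfolding optimal_online_I_def by (metis order.antisym)
  \<comment> \<open>The choice is read off \<open>A\<close>: \<open>True\<close> exactly when
    \<open>A\<close> ends up where setting the first literal leads. Otherwise, if a clause remains,
    \<open>A\<close> is at the other lazy successor.\<close>
  define \<kappa> where
    "\<kappa> = (\<lambda>h. assigns A h = snd (lazy_step True (assigns A (butlast h)) (last h)))"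
  \<comment> \<open>The decision is forced at every clause, the assignment only before the last one:
    afterwards \<open>r = 0\<close> and setting more variables is free.\<close>
  have step: "accepts A (h @ [c]) = fst (lazy_step f (assigns A h) c)"
    "length (h @ [c]) < m \<Longrightarrow> assigns A (h @ [c]) = snd (lazy_step (\<kappa> (h @ [c])) (assigns A h) c)"
    if h: "set (h @ [c]) \<subseteq> clauses n" "length (h @ [c]) \<le> m" for f h c
  proof -
    define r where "r = m - length (h @ [c])"
    have r: "m - length h = Suc r" using h by (simp add: r_def)
    have hyps: "set h \<subseteq> clauses n" "length h < m" "c \<in> clauses n" using h by auto
    have "history_value n A (Suc r) h = lazy_value n (Suc r) (card (dom (assigns A h)))"
      using history_value_maximal[OF n A val, of h] h unfolding r by simp
    then have eq: "step_value (lazy_value n r) (accepts A (h @ [c]), assigns A (h @ [c])) =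
        step_value (lazy_value n r) (lazy_step f (assigns A h) c)" for f
      using r hyps by (intro history_value_maximal_step(2)[OF n A]) auto
    show "accepts A (h @ [c]) = fst (lazy_step f (assigns A h) c)"
      by (rule online_I_step_le(2)[OF n A hyps eq])
    show "assigns A (h @ [c]) = snd (lazy_step (\<kappa> (h @ [c])) (assigns A h) c)"
      if "length (h @ [c]) < m"
    proof -
      have "assigns A (h @ [c]) \<in>
          {snd (lazy_step True (assigns A h) c), snd (lazy_step False (assigns A h) c)}"
        using that by (intro online_I_step_le(3)[OF n A hyps eq]) (simp add: r_def)
      then show ?thesis
        by (cases "\<kappa> (h @ [c])") (auto simp: \<kappa>_def)
    qed
  qed
  \<comment> \<open>Lengths below \<open>m\<close> are enough: \<open>agree\<close> compares
    assignments only when a further clause is presented.\<close>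
  have state: "assigns A h = assigns (online_lazy \<kappa>) h" if "set h \<subseteq> clauses n" "length h < m" for h
    using that
  proof (induction h rule: rev_induct)
    case Nil
    then show ?case using A by (simp add: online_I_def online_lazy_Nil)
  next
    case (snoc c h)
    then show ?case using step(2)[of h c] by (simp add: assigns_online_lazy_snoc)
  qed
  have "agree n m A (online_lazy \<kappa>)"
    unfolding agree_def
  proof (intro allI impI conjI)
    fix h c assume h: "set (h @ [c]) \<subseteq> clauses n \<and> length (h @ [c]) \<le> m"
    then show eq: "assigns A h = assigns (online_lazy \<kappa>) h" by (intro state) auto
    show "accepts A (h @ [c]) = accepts (online_lazy \<kappa>) (h @ [c])"
      unfolding accepts_online_lazy_snoc eq[symmetric] using h by (intro step(1)) auto
  qed
  then show ?thesis by blast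
qed

section \<open>Asymptotics for a linear number of clauses\<close>

text \<open>For large \<open>n\<close> the power equals
  \<open>((1 - a / n) ^ n) powr (m n / n)\<close>, whose base tends to \<open>exp (- a)\<close> and
  whose exponent tends to \<open>c\<close>.\<close>

lemma one_minus_div_power_tendsto:
  fixes a c :: real and m :: "nat \<Rightarrow> nat"
  assumes "(\<lambda>n. real (m n) / real n) \<longlonglongrightarrow> c"
  shows "(\<lambda>n. (1 - a / real n) ^ m n) \<longlonglongrightarrow> exp (- (a * c))"
proof -
  have "(\<lambda>n. (1 + - a / real n) ^ n) \<longlonglongrightarrow> exp (- a)"
    by (rule tendsto_exp_limit_sequentially)
  then have "(\<lambda>n. ((1 + - a / real n) ^ n) powr (real (m n) / real n)) \<longlonglongrightarrow> exp (- a) powr c"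
    using assms by (rule tendsto_powr) simp
  moreover have "exp (- a) powr c = exp (- (a * c))" by (simp add: powr_def mult.commute)
  moreover have "\<forall>\<^sub>F n in sequentially.
      ((1 + - a / real n) ^ n) powr (real (m n) / real n) = (1 - a / real n) ^ m n"
    \<comment> \<open>Beyond \<open>\<bar>a\<bar>\<close> the base \<open>1 - a / n\<close> is
      positive, so natural powers and \<open>powr\<close> can be exchanged.\<close>
    using eventually_gt_at_top[of "nat \<lceil>\<bar>a\<bar>\<rceil>"]
  proof eventually_elim
    case (elim n)
    then have "\<bar>a\<bar> < real n" by linarith
    then have pos: "0 < 1 - a / real n" and n: "real n > 0" by (auto simp: field_simps)
    have "((1 - a / real n) ^ n) powr (real (m n) / real n) =
        (1 - a / real n) powr (real n * (real (m n) / real n))"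
      by (simp only: powr_realpow[OF pos, symmetric] powr_powr)
    also have "\<dots> = (1 - a / real n) ^ m n" using pos n by (simp add: powr_realpow)
    finally show ?case by simp
  qed
  ultimately show ?thesis by (simp add: tendsto_cong)
qed

lemma f_OI_asymptotics:
  fixes c :: real
  assumes "c > 0"
  defines "K \<equiv> 3/4 * c + (1 - exp (- c)) / 4 + (1 - exp (- c))\<^sup>2 / 8"
  shows "(\<lambda>n. f_OI n (nat \<lfloor>c * real n\<rfloor>) / (K * real n)) \<longlonglongrightarrow> 1"
proof -
  define m where "m = (\<lambda>n::nat. nat \<lfloor>c * real n\<rfloor>)"
  have "0 < K" unfolding K_def using assms by (intro add_pos_nonneg) auto
  \<comment> \<open>\<open>K\<close> takes the shape of the closed form at \<open>k = 0\<close>: the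
    powers of the two eigenvalues tend to \<open>exp (- c)\<close> and
    \<open>exp (- (2 * c))\<close>, the square of the former.\<close>
  have K: "K = 3/4 * c + 1/2 * (1 - exp (- (1 * c))) - 1/8 * (1 - exp (- (2 * c)))"
  proof -
    have "exp (- (2 * c)) = (exp (- c))\<^sup>2" by (simp add: exp_double[symmetric])
    then show ?thesis unfolding K_def by (simp add: power2_eq_square field_simps)
  qed
  have m: "(\<lambda>n. real (m n) / real n) \<longlonglongrightarrow> c"
    unfolding m_def
  proof (rule tendsto_sandwich)
    \<comment> \<open>The floor loses less than 1, hence less than \<open>1 / n\<close> after
      division.\<close>
    show "(\<lambda>n. c - 1 / real n) \<longlonglongrightarrow> c"
      using tendsto_diff[OF tendsto_const lim_1_over_n, of c] by simp
    show "\<forall>\<^sub>F n in sequentially. c - 1 / real n \<le> real (nat \<lfloor>c * real n\<rfloor>) / real n"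
      using eventually_gt_at_top[of 0]
    proof eventually_elim
      case (elim n)
      have "c * real n - 1 \<le> real (nat \<lfloor>c * real n\<rfloor>)" by linarith
      then have "(c * real n - 1) / real n \<le> real (nat \<lfloor>c * real n\<rfloor>) / real n"
        by (intro divide_right_mono) auto
      then show ?case using elim by (simp add: diff_divide_distrib)
    qed
    show "\<forall>\<^sub>F n in sequentially. real (nat \<lfloor>c * real n\<rfloor>) / real n \<le> c"
      using eventually_gt_at_top[of 0]
    proof eventually_elim
      case (elim n)
      have "0 \<le> c * real n" using assms(1) by simp
      then have "real (nat \<lfloor>c * real n\<rfloor>) \<le> c * real n" by linarith
      then show ?case using elim by (simp add: field_simps)
    qed
  qed simp
  have "(\<lambda>n. (3/4 * (real (m n) / real n) + 1/2 * (1 - (1 - 1 / real n) ^ m n)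
      - 1/8 * (1 - (1 - 2 / real n) ^ m n)) / K) \<longlonglongrightarrow> K / K"
    \<comment> \<open>Only the numerator of the limit is expanded, to match the sequence term by
      term; the denominators keep \<open>K\<close>.\<close>
    by (subst (2) K) (intro tendsto_intros m one_minus_div_power_tendsto, use \<open>0 < K\<close> in simp)
  moreover have "\<forall>\<^sub>F n in sequentially.
      (3/4 * (real (m n) / real n) + 1/2 * (1 - (1 - 1 / real n) ^ m n)
        - 1/8 * (1 - (1 - 2 / real n) ^ m n)) / K = f_OI n (m n) / (K * real n)"
    using eventually_ge_at_top[of 2]
  proof eventually_elim
    case (elim n)
    then have "real n - 1 \<noteq> 0" "real n \<noteq> 0" by auto
    \<comment> \<open>At \<open>k = 0\<close> the factor \<open>n - 1\<close> cancels and leaves the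
      exact coefficient \<open>n / 8\<close>.\<close>
    then have "real n * (real n - 1) / (8 * (real n - 1)) = real n / 8"
      by (intro nonzero_mult_divide_mult_cancel_right)
    then have "f_OI n (m n) = 3 / 4 * real (m n) + real n / 2 * (1 - (1 - 1 / real n) ^ m n)
        - real n / 8 * (1 - (1 - 2 / real n) ^ m n)"
      by (simp only: f_OI_eq_lazy_value[OF elim] lazy_value_closed_form[OF elim] of_nat_0 diff_zero)
    then show ?case using \<open>real n \<noteq> 0\<close> \<open>0 < K\<close> by (simp add: divide_simps)
  qed
  ultimately have "(\<lambda>n. f_OI n (m n) / (K * real n)) \<longlonglongrightarrow> 1"
    using \<open>0 < K\<close> by (simp add: tendsto_cong)
  then show ?thesis unfolding m_def .
qed

text \<open>The left side increases in \<open>u = 1 - exp (- c)\<close> on \<open>[0, 1]\<close>,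
  and \<open>u = 1\<close> gives \<open>1/4 + 1/8 = 3/8\<close>.\<close>

lemma asymptotic_density_le:
  fixes c :: real
  assumes "c > 0"
  shows "3/4 * c + (1 - exp (- c)) / 4 + (1 - exp (- c))\<^sup>2 / 8 \<le> 3/4 * c + 3/8"
proof -
  define u where "u = 1 - exp (- c)"
  have "u \<le> 1" "0 \<le> u" using assms by (auto simp: u_def)
  moreover from this have "u\<^sup>2 \<le> 1" by (simp add: power_le_one)
  ultimately have "3/4 * c + u / 4 + u\<^sup>2 / 8 \<le> 3/4 * c + 3/8" by linarith
  then show ?thesis unfolding u_def .
qed

theorem theorem17:
  fixes c :: real
  assumes "c > 0"
  shows "(\<forall>n m. n \<ge> 2 \<longrightarrow>
            (\<forall>\<kappa>. optimal_online_I n m (online_lazy \<kappa>)) \<and>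
            (\<forall>A. optimal_online_I n m A \<longrightarrow> (\<exists>\<kappa>. agree n m A (online_lazy \<kappa>)))) \<and>
         (\<lambda>n. f_OI n (nat \<lfloor>c * real n\<rfloor>) /
               ((3/4 * c + (1 - exp (- c)) / 4 + (1 - exp (- c))\<^sup>2 / 8) * real n))
           \<longlonglongrightarrow> 1 \<and>
         (\<forall>n::nat. (3/4 * c + (1 - exp (- c)) / 4 + (1 - exp (- c))\<^sup>2 / 8) * real n
                    \<le> (3/4 * c + 3/8) * real n)"
  using optimal_online_lazy optimal_agrees_online_lazy f_OI_asymptotics[OF assms]
    mult_right_mono[OF asymptotic_density_le[OF assms] of_nat_0_le_iff]
  by blast

end
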